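(* Let $N > 0$ and $0 \leqslant n_0 < \dots < n_{N-1} < M$ be integers. Let $0 < \rho < +\infty$, and let $c_{n_0},\dots,c_{n_{N-1}}$ be positive reals. Then there exists a negative number $c_M$ such that $$x \mapsto c_{n_0} x^{n_0} + c_{n_1} x^{n_1} + \dots + c_{n_{N-1}} x^{n_{N-1}} + c_M x^M$$ entrywise preserves positivity on $\mathbb{P}_N((0,\rho))$.
   Context: For $I \subset \mathbb{C}$, $\mathbb{P}_N(I)$ denotes the set of positive semidefinite Hermitian $N\times N$ matrices all of whose entries lie in $I$. For a function $f$ on $I$ and a matrix $A=(a_{jk})$ with entries in $I$, $f[A] := (f(a_{jk}))$ is the entrywise application of $f$. The function $f$ entrywise preserves positivity on $\mathbb{P}_N(I)$ if $f[A]$ is positive semidefinite for every $A \in \mathbb{P}_N(I)$. *)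

theory Defs
  imports Complex_Main "Jordan_Normal_Form.Schur_Decomposition"
begin

definition hermitian_mat :: "complex mat \<Rightarrow> bool" where
  "hermitian_mat A \<longleftrightarrow> square_mat A \<and> mat_adjoint A = A"

text \<open>The order on \<^typ>\<open>complex\<close> is the one of \<^theory>\<open>HOL-Library.Complex_Order\<close>:
  \<open>0 \<le> z\<close> says that \<open>z\<close> is real and nonnegative.  The form below is \<open>v\<^sup>* A v\<close>.\<close>

definition psd_mat :: "complex mat \<Rightarrow> bool" where
  "psd_mat A \<longleftrightarrow> hermitian_mat A \<and>
     (\<forall>v \<in> carrier_vec (dim_row A). 0 \<le> (A *\<^sub>v v) \<bullet>c v)"

definition psd_mats :: "nat \<Rightarrow> complex set \<Rightarrow> complex mat set" where
  "psd_mats N I = {A \<in> carrier_mat N N. psd_mat A \<and> elements_mat A \<subseteq> I}"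

definition entrywise_preserves_positivity ::
    "(complex \<Rightarrow> complex) \<Rightarrow> nat \<Rightarrow> complex set \<Rightarrow> bool" where
  "entrywise_preserves_positivity f N I \<longleftrightarrow> (\<forall>A \<in> psd_mats N I. psd_mat (map_mat f A))"

end

theory Submission
  imports Defs "HOL-Analysis.Convex"
begin

text \<open>
  Let \<open>f(x) = \<Sum>\<^sub>e c\<^sub>e x\<^sup>e - \<epsilon> x\<^sup>M\<close>, with \<open>N\<close> exponents \<open>e < M\<close> and all \<open>c\<^sub>e > 0\<close>.
  For small \<open>\<epsilon>\<close>, positivity of \<open>f[A]\<close> is shown first for \<open>A\<close> of rank one and then for
  every \<open>A\<close> by induction on \<open>N\<close>.

  Rank one.  For \<open>A = u u\<^sup>T\<close> with \<open>u \<in> (0, \<surd>\<rho>]\<^sup>N\<close>, each power \<open>u\<^sup>m\<close> (taken entrywise) gives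
  a linear form \<open>L\<^sub>m(v) = v \<cdot> u\<^sup>m\<close>, and the claim is \<open>\<epsilon> L\<^sub>M\<^sup>2 \<le> \<Sum>\<^sub>e c\<^sub>e L\<^sub>e\<^sup>2\<close>.  If
  \<open>x\<^sup>M = \<Sum>\<^sub>e d\<^sub>e x\<^sup>e\<close> at all entries \<open>x\<close> of \<open>u\<close>, then \<open>L\<^sub>M = \<Sum>\<^sub>e d\<^sub>e L\<^sub>e\<close>, and the Cauchy-Schwarz
  inequality gives the claim for \<open>\<epsilon> \<le> 1 / (\<Sum>\<^sub>e d\<^sub>e\<^sup>2 / c\<^sub>e)\<close>.  What has to be seen is that the
  interpolation coefficients \<open>d\<^sub>e\<close>, which are ratios of generalised Vandermonde determinants,
  stay bounded when the nodes vary in \<open>(0, \<surd>\<rho>]\<close>, collide, or tend to \<open>0\<close>.  This is lemma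
  \<open>interpolant_coeff_bound\<close>.  It holds by induction on \<open>N\<close>: dividing
  \<open>\<Sum>\<^sub>e d\<^sub>e x\<^sup>e - x\<^sup>M\<close> by its lowest power and differentiating removes one term, and by
  Rolle's theorem only one zero.  The same argument gives uniqueness, and hence existence,
  of the interpolant.

  Induction step (the method of FitzGerald and Horn).  Pick an index \<open>k\<close> and let
  \<open>u = A e\<^sub>k / \<surd>a\<^sub>k\<^sub>k\<close>.  Then \<open>H = A - u u\<^sup>T\<close> is positive semidefinite (a Schur complement)
  and vanishes in row and column \<open>k\<close>.  Along the segment \<open>B\<^sub>t = u u\<^sup>T + t H\<close> the derivative
  of \<open>f[B\<^sub>t]\<close> is the entrywise product of \<open>H\<close> and \<open>f'[B\<^sub>t]\<close>, which matters only on the other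
  \<open>N - 1\<close> indices.  There \<open>f'\<close> has, apart from the nonnegative term coming from the lowest
  exponent, \<open>N - 1\<close> positive coefficients and one small negative one, so \<open>f'[B\<^sub>t]\<close> is positive
  semidefinite by induction, and the derivative is so by the Schur product theorem.  Therefore
  \<open>f[A] \<ge> f[u u\<^sup>T] \<ge> 0\<close>.
\<close>

section \<open>Interpolation by monomials at positive nodes\<close>

text \<open>The bound by \<open>Max S\<close> on the new zeros makes the induction work: the zero found
  between the old maximum and a newly added larger point is then distinct from all earlier
  ones.\<close>

lemma Rolle_zeros:
  fixes g g' :: "real \<Rightarrow> real"
  assumes "finite S" and "S \<noteq> {}" and "S \<subseteq> {0<..r}"
    and deriv: "\<And>x. 0 < x \<Longrightarrow> (g has_real_derivative g' x) (at x)"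
    and "\<And>x. x \<in> S \<Longrightarrow> g x = 0"
  shows "\<exists>T. finite T \<and> T \<subseteq> {0<..<Max S} \<and> Suc (card T) = card S \<and> (\<forall>x\<in>T. g' x = 0)"
  using assms(1,2,3,5)
proof (induction S rule: finite_linorder_max_induct)
  case empty
  then show ?case by simp
next
  case (insert b S)
  show ?case
  proof (cases "S = {}")
    case True
    then show ?thesis by (intro exI[of _ "{}"]) auto
  next
    case False
    then obtain T where T: "finite T" "T \<subseteq> {0<..<Max S}" "Suc (card T) = card S"
      "\<forall>x\<in>T. g' x = 0"
      using insert by auto
    have mem: "Max S \<in> S"
      using insert.hyps False by simp
    have pos: "0 < Max S" and lt: "Max S < b"
      using mem insert by auto
    have "\<exists>z>Max S. z < b \<and> g' z = 0"
    proof -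
      have gz: "g (Max S) = g b"
        using mem insert.prems by simp
      have "continuous_on {Max S..b} g"
        using pos
        by (intro continuous_at_imp_continuous_on ballI DERIV_isCont[OF deriv]) auto
      moreover have "\<And>x. Max S < x \<Longrightarrow> x < b \<Longrightarrow> (g has_derivative (*) (g' x)) (at x)"
        using deriv pos by (auto simp: has_field_derivative_def)
      ultimately obtain z where z: "Max S < z" "z < b" "(*) (g' z) = (\<lambda>v. 0)"
        using Rolle_deriv[OF lt gz, of "\<lambda>x. (*) (g' x)"] by blast
      then show ?thesis by (metis mult.right_neutral)
    qed
    then obtain z where z: "Max S < z" "z < b" "g' z = 0" by blast
    have "Max (insert b S) = b"
      using insert.hyps by (intro Max_eqI) (auto intro: less_imp_le)
    moreover have "z \<notin> T" using T z by auto
    moreover have "b \<notin> S" using insert.hyps by blast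
    ultimately show ?thesis
      using T z pos lt insert.hyps by (intro exI[of _ "insert z T"]) auto
  qed
qed

text \<open>
  Induction on the number of exponents, removing the smallest exponent \<open>b\<close>.  Let
  \<open>p(x) = \<Sum>\<^sub>e d\<^sub>e x\<^sup>e - w x\<^sup>M\<close>.  Up to a positive factor, the derivative of \<open>p(x) / x\<^sup>b\<close> is
  \<open>q(x) = x p'(x) - b p(x)\<close>, which has the same exponents except \<open>b\<close>, with \<open>d\<^sub>e\<close> replaced by
  \<open>(e - b) d\<^sub>e\<close>, and by Rolle's theorem vanishes at enough points for the induction hypothesis.
  This bounds every \<open>d\<^sub>e\<close> with \<open>e \<noteq> b\<close>, and then \<open>d\<^sub>b\<close> is bounded by solving \<open>p(x) = 0\<close> for it
  at one node; since \<open>b\<close> is the smallest exponent, no negative power of \<open>x\<close> appears.  The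
  factor \<open>w\<close> is kept so that the case \<open>w = 0\<close> yields uniqueness.
\<close>

lemma interpolant_coeff_bound:
  fixes r :: real
  assumes "finite E" and "E \<subseteq> {..<M}" and "0 < r"
  shows "\<exists>K\<ge>0. \<forall>d w S. finite S \<longrightarrow> S \<subseteq> {0<..r} \<longrightarrow> card S = card E \<longrightarrow>
           (\<forall>x\<in>S. (\<Sum>e\<in>E. d e * x ^ e) = w * x ^ M) \<longrightarrow> (\<forall>e\<in>E. \<bar>d e\<bar> \<le> K * \<bar>w\<bar>)"
  using assms(1,2)
proof (induction E rule: finite_linorder_min_induct)
  case empty
  then show ?case by (intro exI[of _ 0]) auto
next
  case (insert b E)
  then obtain K where K: "K \<ge> 0" and
    IH: "\<And>d w S e. \<lbrakk>finite S; S \<subseteq> {0<..r}; card S = card E;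
          \<forall>x\<in>S. (\<Sum>e\<in>E. d e * x ^ e) = w * x ^ M; e \<in> E\<rbrakk> \<Longrightarrow> \<bar>d e\<bar> \<le> K * \<bar>w\<bar>"
    by (meson insert_subset)
  have bM: "b < M" and bE: "b \<notin> E" and gt: "\<And>e. e \<in> E \<Longrightarrow> b < e"
    using insert by auto
  define K1 where "K1 = K * real (M - b)"
  define K0 where "K0 = r ^ (M - b) + (\<Sum>e\<in>E. K1 * r ^ (e - b))"
  have K1: "K1 \<ge> 0" using K by (simp add: K1_def)
  have K0: "K0 \<ge> 0"
    unfolding K0_def using K1 \<open>0 < r\<close> by (intro add_nonneg_nonneg sum_nonneg mult_nonneg_nonneg) auto
  show ?case
  proof (intro exI[of _ "K0 + K1"] conjI allI impI)
    show "0 \<le> K0 + K1" using K0 K1 by simp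
  next
    fix d :: "nat \<Rightarrow> real" and w S
    assume S: "finite S" "S \<subseteq> {0<..r}" "card S = card (insert b E)"
      and eq: "\<forall>x\<in>S. (\<Sum>e\<in>insert b E. d e * x ^ e) = w * x ^ M"
    define p where "p x = (\<Sum>e\<in>insert b E. d e * x ^ e) - w * x ^ M" for x
    define q where "q x = (\<Sum>e\<in>E. (d e * real (e - b)) * x ^ e) - w * real (M - b) * x ^ M" for x
    have q_eq: "q x = (\<Sum>e\<in>insert b E. d e * (real e * x ^ e)) - w * (real M * x ^ M) - real b * p x" for x
    proof -
      have "(\<Sum>e\<in>insert b E. d e * (real e * x ^ e)) - w * (real M * x ^ M) - real b * p x
          = (\<Sum>e\<in>E. d e * (real e * x ^ e)) - real b * (\<Sum>e\<in>E. d e * x ^ e)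
             - w * real (M - b) * x ^ M"
        using bE bM insert.hyps by (simp add: p_def algebra_simps of_nat_diff)
      also have "\<dots> = q x"
        unfolding q_def sum_distrib_left sum_subtractf[symmetric]
        using gt by (auto intro!: sum.cong simp: of_nat_diff less_imp_le algebra_simps)
      finally show ?thesis by simp
    qed
    have xpow: "x * (real e * x ^ (e - Suc 0)) = real e * x ^ e" for x :: real and e
      by (cases e) auto
    have deriv: "((\<lambda>x. p x / x ^ b) has_real_derivative q x / x ^ Suc b) (at x)" if "0 < x" for x
    proof -
      define p' where "p' = (\<Sum>e\<in>insert b E. d e * (real e * x ^ (e - Suc 0))) - w * (real M * x ^ (M - Suc 0))"
      have "(p has_real_derivative p') (at x)"
        unfolding p_def p'_def by (auto intro!: derivative_eq_intros sum.cong)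
      moreover have "((\<lambda>x. x ^ b) has_real_derivative real b * x ^ (b - Suc 0)) (at x)"
        by (auto intro!: derivative_eq_intros)
      ultimately have D: "((\<lambda>x. p x / x ^ b) has_real_derivative
          (p' * x ^ b - p x * (real b * x ^ (b - Suc 0))) / (x ^ b * x ^ b)) (at x)"
        using that by (intro DERIV_divide) auto
      have xp': "x * p' = (\<Sum>e\<in>insert b E. d e * (real e * x ^ e)) - w * (real M * x ^ M)"
        unfolding p'_def right_diff_distrib sum_distrib_left
        by (simp only: xpow mult.left_commute[of x])
      have "x * (p' * x ^ b - p x * (real b * x ^ (b - Suc 0)))
          = x * p' * x ^ b - p x * (x * (real b * x ^ (b - Suc 0)))"
        by (simp add: algebra_simps)
      also have "\<dots> = q x * x ^ b"
        unfolding xpow q_eq xp' by (simp add: algebra_simps)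
      finally have "(p' * x ^ b - p x * (real b * x ^ (b - Suc 0))) / (x ^ b * x ^ b) = q x / x ^ Suc b"
        using that by (simp add: frac_eq_eq mult_ac)
      with D show ?thesis by simp
    qed
    have cS: "card S = Suc (card E)"
      using S bE insert.hyps by simp
    then have Sne: "S \<noteq> {}" by auto
    have "p x / x ^ b = 0" if "x \<in> S" for x
      using eq that by (simp add: p_def)
    from Rolle_zeros[OF S(1) Sne S(2) deriv this]
    obtain T where T: "finite T" "T \<subseteq> {0<..<Max S}" "Suc (card T) = card S"
      and Tz: "\<forall>x\<in>T. q x / x ^ Suc b = 0"
      by blast
    have "Max S \<in> S" using S Sne by simp
    then have Tr: "T \<subseteq> {0<..r}" using T S by force
    have "\<forall>x\<in>T. (\<Sum>e\<in>E. (d e * real (e - b)) * x ^ e) = (w * real (M - b)) * x ^ M"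
      using Tz Tr by (force simp: q_def)
    then have "\<bar>d e * real (e - b)\<bar> \<le> K * \<bar>w * real (M - b)\<bar>" if "e \<in> E" for e
      using IH[OF T(1) Tr, of "\<lambda>e. d e * real (e - b)" "w * real (M - b)" e] T(3) cS that by simp
    moreover have "\<bar>d e\<bar> \<le> \<bar>d e * real (e - b)\<bar>" if "e \<in> E" for e
      using gt[OF that] mult_left_mono[of 1 "real (e - b)" "\<bar>d e\<bar>"] by (simp add: abs_mult)
    ultimately have upper: "\<bar>d e\<bar> \<le> K1 * \<bar>w\<bar>" if "e \<in> E" for e
      using that by (force simp: K1_def abs_mult mult_ac)
    \<comment> \<open>The remaining coefficient \<open>d b\<close> is read off at a single node.\<close>
    obtain x where x: "x \<in> S" "0 < x" "x \<le> r"
      using Sne S by fastforce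
    have pw: "x ^ b * (k * x ^ (e - b)) = k * x ^ e" if "b \<le> e" for e and k :: real
      using that by (simp add: mult.left_commute flip: power_add)
    have "x ^ b * (d b + (\<Sum>e\<in>E. d e * x ^ (e - b))) = (\<Sum>e\<in>insert b E. d e * x ^ e)"
      using bE insert.hyps gt
      by (simp add: distrib_left sum_distrib_left pw less_imp_le mult.commute)
    also have "\<dots> = x ^ b * (w * x ^ (M - b))"
      using eq x bM by (simp only: pw less_imp_le)
    finally have "d b = w * x ^ (M - b) - (\<Sum>e\<in>E. d e * x ^ (e - b))"
      using x by auto
    also have "\<bar>\<dots>\<bar> \<le> \<bar>w * x ^ (M - b)\<bar> + (\<Sum>e\<in>E. \<bar>d e * x ^ (e - b)\<bar>)"
      using sum_abs[of "\<lambda>e. d e * x ^ (e - b)" E] by linarith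
    also have "\<dots> \<le> \<bar>w\<bar> * r ^ (M - b) + (\<Sum>e\<in>E. (K1 * \<bar>w\<bar>) * r ^ (e - b))"
      using x upper K1 unfolding abs_mult
      by (intro add_mono sum_mono mult_mono) (auto intro: power_mono)
    also have "\<dots> = K0 * \<bar>w\<bar>"
      by (simp add: K0_def algebra_simps sum_distrib_left)
    finally have low: "\<bar>d b\<bar> \<le> K0 * \<bar>w\<bar>" .
    show "\<forall>e\<in>insert b E. \<bar>d e\<bar> \<le> (K0 + K1) * \<bar>w\<bar>"
    proof
      fix e assume "e \<in> insert b E"
      then have "\<bar>d e\<bar> \<le> K0 * \<bar>w\<bar> \<or> \<bar>d e\<bar> \<le> K1 * \<bar>w\<bar>"
        using low upper by auto
      moreover have "0 \<le> K0 * \<bar>w\<bar>" "0 \<le> K1 * \<bar>w\<bar>"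
        using K0 K1 by simp_all
      ultimately show "\<bar>d e\<bar> \<le> (K0 + K1) * \<bar>w\<bar>"
        unfolding distrib_right by linarith
    qed
  qed
qed

text \<open>A weak form of Descartes' rule of signs: a combination of \<open>N\<close> monomials that has \<open>N\<close>
  positive zeros is the zero combination.\<close>

lemma interpolant_unique:
  fixes d :: "nat \<Rightarrow> real"
  assumes "finite E" and "finite S" and "S \<subseteq> {0<..}" and "card S = card E"
    and "\<And>x. x \<in> S \<Longrightarrow> (\<Sum>e\<in>E. d e * x ^ e) = 0" and "e \<in> E"
  shows "d e = 0"
proof -
  have "S \<noteq> {}" using assms by auto
  then have "Max S \<in> S" using assms by simp
  then have S: "S \<subseteq> {0<..Max S}" "0 < Max S"
    using assms by auto
  obtain M where "E \<subseteq> {..<M}"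
    using finite_nat_iff_bounded[THEN iffD1, OF \<open>finite E\<close>] by blast
  from interpolant_coeff_bound[OF \<open>finite E\<close> this S(2)]
  obtain K where bound: "\<And>d w T. \<lbrakk>finite T; T \<subseteq> {0<..Max S}; card T = card E;
     \<forall>x\<in>T. (\<Sum>e\<in>E. d e * x ^ e) = w * x ^ M\<rbrakk> \<Longrightarrow> \<forall>e\<in>E. \<bar>d e\<bar> \<le> K * \<bar>w\<bar>"
    by blast
  have "\<forall>e\<in>E. \<bar>d e\<bar> \<le> K * \<bar>0\<bar>"
    using assms S by (intro bound[of S]) auto
  then show ?thesis using \<open>e \<in> E\<close> by auto
qed

text \<open>Newton's scheme: for one more node \<open>s\<close>, the interpolant at the old nodes is corrected by
  a multiple of a function \<open>g\<close> that vanishes at the old nodes; uniqueness ensures \<open>g s \<noteq> 0\<close>.\<close>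

lemma interpolant_exists:
  fixes y :: "real \<Rightarrow> real"
  assumes "finite E" and "finite S" and "S \<subseteq> {0<..}" and "card S = card E"
  shows "\<exists>d. \<forall>x\<in>S. (\<Sum>e\<in>E. d e * x ^ e) = y x"
  using assms
proof (induction E arbitrary: S y rule: finite_induct)
  case empty
  then show ?case by simp
next
  case (insert b E)
  then obtain s where s: "s \<in> S" by fastforce
  define S' where "S' = S - {s}"
  have S': "finite S'" "S' \<subseteq> {0<..}" "card S' = card E"
    using insert s by (auto simp: S'_def)
  obtain d1 where d1: "\<forall>x\<in>S'. (\<Sum>e\<in>E. d1 e * x ^ e) = y x"
    using insert.IH[OF S', of y] by blast
  obtain d2 where d2: "\<forall>x\<in>S'. (\<Sum>e\<in>E. d2 e * x ^ e) = - (x ^ b)"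
    using insert.IH[OF S', of "\<lambda>x. - (x ^ b)"] by blast
  define g where "g x = x ^ b + (\<Sum>e\<in>E. d2 e * x ^ e)" for x
  have g: "g x = (\<Sum>e\<in>insert b E. (d2(b := 1)) e * x ^ e)" for x
    using insert.hyps by (auto simp: g_def intro!: sum.cong)
  have "g s \<noteq> 0"
  proof
    assume "g s = 0"
    moreover have "g x = 0" if "x \<in> S'" for x
      using d2 that by (simp add: g_def)
    ultimately have "g x = 0" if "x \<in> S" for x
      using that by (cases "x = s") (simp_all add: S'_def)
    then have "(d2(b := 1)) b = 0"
      using insert.hyps insert.prems unfolding g
      by (intro interpolant_unique[of "insert b E" S "d2(b := 1)"]) auto
    then show False by simp
  qed
  define t where "t = (y s - (\<Sum>e\<in>E. d1 e * s ^ e)) / g s"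
  have "(\<Sum>e\<in>insert b E. ((\<lambda>e. d1 e + t * d2 e)(b := t)) e * x ^ e) = y x" if "x \<in> S" for x
  proof -
    have "(\<Sum>e\<in>insert b E. ((\<lambda>e. d1 e + t * d2 e)(b := t)) e * x ^ e)
        = t * x ^ b + (\<Sum>e\<in>E. (d1 e + t * d2 e) * x ^ e)"
      using insert.hyps by (auto intro!: sum.cong)
    also have "\<dots> = (\<Sum>e\<in>E. d1 e * x ^ e) + t * g x"
      by (simp add: g_def algebra_simps sum.distrib sum_distrib_left)
    also have "\<dots> = y x"
      using d1 d2 that \<open>g s \<noteq> 0\<close> by (cases "x = s") (auto simp: t_def g_def S'_def)
    finally show ?thesis .
  qed
  then show ?case by blast
qed

text \<open>Fewer nodes than exponents are allowed: extra nodes are added until the numbers agree.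
  Thus a vector with repeated entries causes no degeneration in the rank-one case.\<close>

lemma power_interpolated_boundedly:
  fixes r :: real
  assumes "finite E" and "E \<subseteq> {..<M}" and "0 < r"
  obtains K where "0 \<le> K"
    and "\<And>U. \<lbrakk>finite U; U \<subseteq> {0<..r}; card U \<le> card E\<rbrakk> \<Longrightarrow>
      \<exists>d. (\<forall>x\<in>U. x ^ M = (\<Sum>e\<in>E. d e * x ^ e)) \<and> (\<forall>e\<in>E. \<bar>d e\<bar> \<le> K)"
proof -
  obtain K where K: "0 \<le> K" and bound:
    "\<And>d w S. \<lbrakk>finite S; S \<subseteq> {0<..r}; card S = card E;
       \<forall>x\<in>S. (\<Sum>e\<in>E. d e * x ^ e) = w * x ^ M\<rbrakk> \<Longrightarrow> \<forall>e\<in>E. \<bar>d e\<bar> \<le> K * \<bar>w\<bar>"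
    using interpolant_coeff_bound[OF assms] by blast
  have "\<exists>d. (\<forall>x\<in>U. x ^ M = (\<Sum>e\<in>E. d e * x ^ e)) \<and> (\<forall>e\<in>E. \<bar>d e\<bar> \<le> K)"
    if U: "finite U" "U \<subseteq> {0<..r}" "card U \<le> card E" for U
  proof -
    have "infinite ({0<..r} - U)"
      using \<open>0 < r\<close> U(1) by (simp add: infinite_Ioc)
    then obtain V where V: "V \<subseteq> {0<..r} - U" "finite V" "card V = card E - card U"
      using infinite_arbitrarily_large by blast
    have S: "finite (U \<union> V)" "U \<union> V \<subseteq> {0<..r}" "card (U \<union> V) = card E"
    proof -
      show "card (U \<union> V) = card E"
        using U V by (subst card_Un_disjoint) auto
    qed (use U V in auto)
    moreover have "U \<union> V \<subseteq> {0<..}" using S by auto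
    ultimately obtain d where d: "\<forall>x\<in>U \<union> V. (\<Sum>e\<in>E. d e * x ^ e) = x ^ M"
      using interpolant_exists[OF \<open>finite E\<close>, of "U \<union> V" "\<lambda>x. x ^ M"] by blast
    with bound[OF S, of d 1] show ?thesis by (intro exI[of _ d]) auto
  qed
  with K that show ?thesis by blast
qed

section \<open>Real positive semidefinite forms on a finite index set\<close>

text \<open>Matrices are functions of two indices ranging over an arbitrary finite set, so that
  passing to a principal submatrix only means shrinking the set.\<close>

definition qform :: "'i set \<Rightarrow> ('i \<Rightarrow> 'i \<Rightarrow> real) \<Rightarrow> ('i \<Rightarrow> real) \<Rightarrow> real" where
  "qform I a v = (\<Sum>i\<in>I. \<Sum>j\<in>I. v i * a i j * v j)"

definition psd_on :: "'i set \<Rightarrow> ('i \<Rightarrow> 'i \<Rightarrow> real) \<Rightarrow> bool" where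
  "psd_on I a \<longleftrightarrow> (\<forall>i\<in>I. \<forall>j\<in>I. a i j = a j i) \<and> (\<forall>v. 0 \<le> qform I a v)"

lemma psd_onI:
  assumes "\<And>i j. i \<in> I \<Longrightarrow> j \<in> I \<Longrightarrow> a i j = a j i" and "\<And>v. 0 \<le> qform I a v"
  shows "psd_on I a"
  using assms by (auto simp: psd_on_def)

lemma psd_on_sym: "psd_on I a \<Longrightarrow> i \<in> I \<Longrightarrow> j \<in> I \<Longrightarrow> a i j = a j i"
  and psd_on_nonneg: "psd_on I a \<Longrightarrow> 0 \<le> qform I a v"
  by (auto simp: psd_on_def)

lemma qform_add: "qform I (\<lambda>i j. a i j + b i j) v = qform I a v + qform I b v"
  by (simp add: qform_def algebra_simps sum.distrib)

lemma qform_scale: "qform I (\<lambda>i j. t * a i j) v = t * qform I a v"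
  by (simp add: qform_def algebra_simps sum_distrib_left)

lemma qform_diff: "qform I (\<lambda>i j. a i j - b i j) v = qform I a v - qform I b v"
  by (simp add: qform_def algebra_simps sum_subtractf)

lemma qform_sum: "qform I (\<lambda>i j. \<Sum>e\<in>E. a e i j) v = (\<Sum>e\<in>E. qform I (a e) v)"
  unfolding qform_def sum_distrib_left sum_distrib_right
  by (subst (2) sum.swap, subst sum.swap) (rule refl)

lemma qform_rank_one: "qform I (\<lambda>i j. x i * x j) v = (\<Sum>i\<in>I. v i * x i)\<^sup>2"
  by (simp add: qform_def power2_eq_square sum_product mult_ac)

lemma qform_cong:
  assumes "\<And>i j. i \<in> I \<Longrightarrow> j \<in> I \<Longrightarrow> a i j = b i j"
  shows "qform I a v = qform I b v"
  using assms by (simp add: qform_def cong: sum.cong)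

lemma psd_on_add: "psd_on I a \<Longrightarrow> psd_on I b \<Longrightarrow> psd_on I (\<lambda>i j. a i j + b i j)"
  by (simp add: psd_on_def qform_add)

lemma psd_on_scale: "psd_on I a \<Longrightarrow> 0 \<le> t \<Longrightarrow> psd_on I (\<lambda>i j. t * a i j)"
  by (simp add: psd_on_def qform_scale)

lemma psd_on_rank_one: "psd_on I (\<lambda>i j. x i * x j)"
  by (simp add: psd_on_def qform_rank_one mult.commute)

lemma qform_subset:
  assumes "finite I" and "J \<subseteq> I"
    and "\<And>i j. \<lbrakk>i \<in> I; j \<in> I; i \<notin> J \<or> j \<notin> J\<rbrakk> \<Longrightarrow> v i * a i j * v j = 0"
  shows "qform I a v = qform J a v"
proof -
  have "(\<Sum>i\<in>I. \<Sum>j\<in>I. v i * a i j * v j) = (\<Sum>i\<in>J. \<Sum>j\<in>I. v i * a i j * v j)"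
    using assms by (intro sum.mono_neutral_right) (auto intro!: sum.neutral)
  also have "\<dots> = (\<Sum>i\<in>J. \<Sum>j\<in>J. v i * a i j * v j)"
    using assms by (intro sum.cong refl sum.mono_neutral_right) auto
  finally show ?thesis by (simp add: qform_def)
qed

lemma psd_on_subset:
  assumes "psd_on I a" and "finite I" and "J \<subseteq> I"
  shows "psd_on J a"
proof (rule psd_onI)
  fix v :: "'a \<Rightarrow> real"
  define w where "w i = (if i \<in> J then v i else 0)" for i
  have "qform J a v = qform J a w"
    by (simp add: qform_def w_def cong: sum.cong)
  also have "\<dots> = qform I a w"
    using assms by (intro qform_subset[symmetric]) (auto simp: w_def)
  finally show "0 \<le> qform J a v"
    using assms(1) by (simp add: psd_on_nonneg)
qed (rule psd_on_sym[OF assms(1)]; use assms(3) in auto)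

lemma qform_shift:
  assumes "finite I" and "k \<in> I" and "\<And>i j. i \<in> I \<Longrightarrow> j \<in> I \<Longrightarrow> a i j = a j i"
  shows "qform I a (\<lambda>i. v i + (if i = k then t else 0))
    = qform I a v + 2 * t * (\<Sum>i\<in>I. v i * a i k) + t\<^sup>2 * a k k"
proof -
  have pt: "(v i + (if i = k then t else 0)) * a i j * (v j + (if j = k then t else 0))
    = v i * a i j * v j + (if j = k then v i * a i k * t else 0)
      + (if i = k then t * a k j * v j else 0) + (if i = k then if j = k then t * a k k * t else 0 else 0)"
    for i j by (auto simp: algebra_simps)
  have "qform I a (\<lambda>i. v i + (if i = k then t else 0))
    = qform I a v + (\<Sum>i\<in>I. v i * a i k * t) + (\<Sum>j\<in>I. t * a k j * v j) + t * a k k * t"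
  proof -
    have "(\<Sum>i\<in>I. \<Sum>j\<in>I. if i = k then t * a k j * v j else 0) = (\<Sum>j\<in>I. t * a k j * v j)"
      using assms(1,2) by (subst sum.swap) simp
    moreover have "(\<Sum>i\<in>I. \<Sum>j\<in>I. if i = k then if j = k then t * a k k * t else 0 else 0) = t * a k k * t"
      using assms(1,2) by (subst sum.swap) simp
    ultimately show ?thesis
      unfolding qform_def pt sum.distrib using assms(1,2) by simp
  qed
  also have "(\<Sum>j\<in>I. t * a k j * v j) = (\<Sum>i\<in>I. v i * a i k * t)"
    using assms by (intro sum.cong) (auto simp: mult_ac)
  finally show ?thesis
    by (simp add: sum_distrib_left power2_eq_square mult_ac)
qed

lemma qform_unit:
  assumes "finite I" and "k \<in> I"
  shows "qform I a (\<lambda>i. if i = k then 1 else 0) = a k k"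
proof -
  have "qform I a (\<lambda>i. if i = k then 1 else 0) = qform {k} a (\<lambda>i. if i = k then 1 else 0)"
    using assms by (intro qform_subset) auto
  then show ?thesis by (simp add: qform_def)
qed

lemma psd_on_diag_nonneg:
  assumes "psd_on I a" and "finite I" and "k \<in> I"
  shows "0 \<le> a k k"
  using psd_on_nonneg[OF assms(1)] qform_unit[OF assms(2,3)] by metis

lemma psd_on_shift_nonneg:
  assumes "psd_on I a" and "finite I" and "k \<in> I"
  shows "0 \<le> qform I a v + 2 * t * (\<Sum>i\<in>I. v i * a i k) + t\<^sup>2 * a k k"
proof -
  have "qform I a (\<lambda>i. v i + (if i = k then t else 0))
      = qform I a v + 2 * t * (\<Sum>i\<in>I. v i * a i k) + t\<^sup>2 * a k k"
    using assms(2,3) psd_on_sym[OF assms(1)] by (rule qform_shift)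
  then show ?thesis
    using psd_on_nonneg[OF assms(1)] by metis
qed

text \<open>The form is evaluated at \<open>e\<^sub>i + t e\<^sub>k\<close>, where the right choice of \<open>t\<close> minimises it, or, if
  \<open>a k k = 0\<close>, makes it negative unless \<open>a i k = 0\<close>.\<close>

lemma psd_on_entry_square_le:
  assumes "psd_on I a" and "finite I" and "i \<in> I" and "k \<in> I"
  shows "(a i k)\<^sup>2 \<le> a i i * a k k"
proof -
  let ?e = "\<lambda>j. if j = i then 1 else 0 :: real"
  have "(\<Sum>j\<in>I. ?e j * a j k) = (\<Sum>j\<in>I. if j = i then a i k else 0)"
    by (intro sum.cong) auto
  also have "\<dots> = a i k" using assms(2,3) by simp
  finally have *: "0 \<le> a i i + 2 * t * a i k + t\<^sup>2 * a k k" for t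
    using psd_on_shift_nonneg[OF assms(1,2,4), of ?e t]
    unfolding qform_unit[OF assms(2,3)] by simp
  show ?thesis
  proof (cases "a k k = 0")
    case True
    have "a i k = 0"
    proof (rule ccontr)
      assume "a i k \<noteq> 0"
      then show False using *[of "- (a i i + 1) / (2 * a i k)"] True by (simp add: field_simps)
    qed
    then show ?thesis using True by simp
  next
    case False
    then have "0 < a k k" using psd_on_diag_nonneg[OF assms(1,2,4)] by simp
    then show ?thesis using *[of "- a i k / a k k"] by (simp add: field_simps power2_eq_square)
  qed
qed

text \<open>The form of the Schur complement at \<open>v\<close> is the minimum over \<open>t\<close> of the form of \<open>a\<close> at
  \<open>v + t e\<^sub>k\<close>.  If \<open>a k k = 0\<close>, the convention \<open>x / 0 = 0\<close> leaves \<open>a\<close> unchanged; its \<open>k\<close>-th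
  column is then already zero.\<close>

lemma psd_on_Schur_complement:
  assumes "psd_on I a" and "finite I" and "k \<in> I"
  shows "psd_on I (\<lambda>i j. a i j - a i k * a j k / a k k)"
proof (rule psd_onI)
  fix i j assume "i \<in> I" "j \<in> I"
  then show "a i j - a i k * a j k / a k k = a j i - a j k * a i k / a k k"
    using psd_on_sym[OF assms(1)] by simp
next
  fix v
  let ?L = "\<Sum>i\<in>I. v i * a i k"
  have "qform I (\<lambda>i j. a i j - a i k * a j k / a k k) v
      = qform I a v - qform I (\<lambda>i j. (1 / a k k) * (a i k * a j k)) v"
    by (simp add: qform_diff)
  also have "\<dots> = qform I a v - ?L\<^sup>2 / a k k"
    unfolding qform_scale qform_rank_one by simp
  also have "0 \<le> qform I a v - ?L\<^sup>2 / a k k"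
    using psd_on_shift_nonneg[OF assms, of v "- ?L / a k k"]
      psd_on_nonneg[OF assms(1), of v]
    by (cases "a k k = 0") (simp_all add: field_simps power2_eq_square)
  finally show "0 \<le> qform I (\<lambda>i j. a i j - a i k * a j k / a k k) v" .
qed

lemma Schur_complement_column_zero:
  assumes "psd_on I a" and "finite I" and "i \<in> I" and "k \<in> I"
  shows "a i k - a i k * a k k / a k k = 0"
  using psd_on_entry_square_le[OF assms] by (cases "a k k = 0") auto

text \<open>Splitting \<open>a\<close> into the rank-one part of column \<open>k\<close> and the Schur complement \<open>h\<close>: the
  entrywise product of \<open>x x\<^sup>T\<close> with \<open>b\<close> is a congruence of \<open>b\<close> by a diagonal matrix, and \<open>h\<close> lives
  on the smaller index set, where the induction hypothesis applies.\<close>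

theorem Schur_product:
  assumes "finite I" and "psd_on I a" and "psd_on I b"
  shows "psd_on I (\<lambda>i j. a i j * b i j)"
  using assms
proof (induction I arbitrary: a rule: finite_induct)
  case empty
  then show ?case by (simp add: psd_on_def qform_def)
next
  case (insert k I)
  let ?I = "insert k I"
  define h where "h i j = a i j - a i k * a j k / a k k" for i j
  have fin: "finite ?I" and k: "k \<in> ?I" using insert.hyps by auto
  have h: "psd_on ?I h"
    unfolding h_def using psd_on_Schur_complement[OF insert.prems(1) fin k] .
  have col: "h i k = 0" if "i \<in> ?I" for i
    using Schur_complement_column_zero[OF insert.prems(1) fin that k] by (simp add: h_def)
  have row: "h k i = 0" if "i \<in> ?I" for i
    using col[OF that] psd_on_sym[OF h that k] by simp
  have sub: "I \<subseteq> ?I" by blast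
  have hb: "psd_on I (\<lambda>i j. h i j * b i j)"
    using insert.IH psd_on_subset[OF h fin sub] psd_on_subset[OF insert.prems(2) fin sub] .
  show ?case
  proof (rule psd_onI)
    fix i j assume "i \<in> ?I" "j \<in> ?I"
    then show "a i j * b i j = a j i * b j i"
      using psd_on_sym[OF insert.prems(1)] psd_on_sym[OF insert.prems(2)] by metis
  next
    fix v
    have "qform ?I (\<lambda>i j. a i j * b i j) v
        = qform ?I (\<lambda>i j. (1 / a k k) * (a i k * b i j * a j k)) v + qform ?I (\<lambda>i j. h i j * b i j) v"
      unfolding qform_add[symmetric] by (intro qform_cong) (simp add: h_def algebra_simps)
    also have "qform ?I (\<lambda>i j. (1 / a k k) * (a i k * b i j * a j k)) v
        = (1 / a k k) * qform ?I b (\<lambda>i. v i * a i k)"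
      unfolding qform_scale by (simp add: qform_def mult_ac)
    also have "qform ?I (\<lambda>i j. h i j * b i j) v = qform I (\<lambda>i j. h i j * b i j) v"
      using row col by (intro qform_subset fin sub) auto
    finally show "0 \<le> qform ?I (\<lambda>i j. a i j * b i j) v"
      using psd_on_nonneg[OF hb] psd_on_nonneg[OF insert.prems(2)]
        psd_on_diag_nonneg[OF insert.prems(1) fin k] by simp
  qed
qed

lemma psd_on_power:
  assumes "finite I" and "psd_on I a"
  shows "psd_on I (\<lambda>i j. a i j ^ m)"
proof (induction m)
  case 0
  then show ?case using psd_on_rank_one[of I "\<lambda>_. 1"] by simp
next
  case (Suc m)
  then show ?case using Schur_product[OF assms Suc] by simp
qed

section \<open>Entrywise polynomials with one negative coefficient\<close>

text \<open>This is the Cauchy-Schwarz argument of the introduction; the coefficient bound \<open>K\<close> makes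
  \<open>\<delta>\<close> independent of \<open>u\<close>.\<close>

lemma rank_one_entrywise_psd:
  fixes c :: "nat \<Rightarrow> real"
  assumes "finite E" and "E \<subseteq> {..<M}" and "\<And>e. e \<in> E \<Longrightarrow> 0 < c e" and "0 < r"
  shows "\<exists>\<delta>>0. \<forall>\<epsilon>\<le>\<delta>. \<forall>(I :: 'i set) u. finite I \<longrightarrow> card I \<le> card E \<longrightarrow> (\<forall>i\<in>I. u i \<in> {0<..r}) \<longrightarrow>
    psd_on I (\<lambda>i j. (\<Sum>e\<in>E. c e * (u i * u j) ^ e) - \<epsilon> * (u i * u j) ^ M)"
proof -
  obtain K where K: "0 \<le> K" and interp:
    "\<And>U. \<lbrakk>finite U; U \<subseteq> {0<..r}; card U \<le> card E\<rbrakk> \<Longrightarrow>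
      \<exists>d. (\<forall>x\<in>U. x ^ M = (\<Sum>e\<in>E. d e * x ^ e)) \<and> (\<forall>e\<in>E. \<bar>d e\<bar> \<le> K)"
    using power_interpolated_boundedly[OF assms(1,2,4)] by metis
  \<comment> \<open>The summand 1 keeps \<open>B\<close> positive when \<open>K = 0\<close> or \<open>E\<close> is empty.\<close>
  define B where "B = 1 + (\<Sum>e\<in>E. K\<^sup>2 / c e)"
  have B: "1 \<le> B"
    unfolding B_def using assms(3) by (auto intro!: sum_nonneg divide_nonneg_pos)
  show ?thesis
  proof (intro exI[of _ "1 / B"] conjI allI impI)
    show "0 < 1 / B" using B by simp
  next
    fix \<epsilon> and I :: "'i set" and u
    assume \<epsilon>: "\<epsilon> \<le> 1 / B" and I: "finite I" "card I \<le> card E" and u: "\<forall>i\<in>I. u i \<in> {0<..r}"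
    have "finite (u ` I)" "u ` I \<subseteq> {0<..r}" "card (u ` I) \<le> card E"
      using card_image_le[OF I(1), of u] I u by auto
    from interp[OF this] obtain d where d: "\<And>i. i \<in> I \<Longrightarrow> u i ^ M = (\<Sum>e\<in>E. d e * u i ^ e)"
      and dK: "\<And>e. e \<in> E \<Longrightarrow> \<bar>d e\<bar> \<le> K"
      by auto
    show "psd_on I (\<lambda>i j. (\<Sum>e\<in>E. c e * (u i * u j) ^ e) - \<epsilon> * (u i * u j) ^ M)"
    proof (rule psd_onI)
      fix v
      define L where "L m = (\<Sum>i\<in>I. v i * u i ^ m)" for m
      have pw: "qform I (\<lambda>i j. (u i * u j) ^ m) v = (L m)\<^sup>2" for m
        unfolding power_mult_distrib qform_rank_one L_def ..
      define Q where "Q = (\<Sum>e\<in>E. c e * (L e)\<^sup>2)"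
      have Q: "0 \<le> Q"
        unfolding Q_def using assms(3) by (intro sum_nonneg mult_nonneg_nonneg) (auto intro: less_imp_le)
      have "L M = (\<Sum>i\<in>I. \<Sum>e\<in>E. v i * (d e * u i ^ e))"
        unfolding L_def using d by (simp add: sum_distrib_left)
      also have "\<dots> = (\<Sum>e\<in>E. d e * L e)"
        by (subst sum.swap) (simp add: L_def sum_distrib_left mult_ac)
      also have "\<dots> = (\<Sum>e\<in>E. (d e / sqrt (c e)) * (sqrt (c e) * L e))"
        using assms(3) by (intro sum.cong) (auto simp: less_imp_neq[symmetric])
      finally have "(L M)\<^sup>2 \<le> (\<Sum>e\<in>E. (d e / sqrt (c e))\<^sup>2) * (\<Sum>e\<in>E. (sqrt (c e) * L e)\<^sup>2)"
        using Cauchy_Schwarz_ineq_sum[of "\<lambda>e. d e / sqrt (c e)" "\<lambda>e. sqrt (c e) * L e" E] by simp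
      also have "(\<Sum>e\<in>E. (sqrt (c e) * L e)\<^sup>2) = Q"
        unfolding Q_def using assms(3)
        by (intro sum.cong) (auto simp: power_mult_distrib less_imp_le)
      also have "(\<Sum>e\<in>E. (d e / sqrt (c e))\<^sup>2) \<le> (\<Sum>e\<in>E. K\<^sup>2 / c e)"
      proof (intro sum_mono)
        fix e assume e: "e \<in> E"
        have "(d e)\<^sup>2 \<le> K\<^sup>2" using power_mono[OF dK[OF e], of 2] by simp
        then show "(d e / sqrt (c e))\<^sup>2 \<le> K\<^sup>2 / c e"
          using assms(3)[OF e] by (simp add: power_divide divide_right_mono)
      qed
      also have "\<dots> \<le> B" by (simp add: B_def)
      finally have LM: "(L M)\<^sup>2 \<le> B * Q"
        using Q by (simp add: mult_right_mono)
      have "\<epsilon> * (L M)\<^sup>2 \<le> (1 / B) * (L M)\<^sup>2"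
        using \<epsilon> by (intro mult_right_mono) auto
      also have "\<dots> \<le> Q" using LM B by (simp add: field_simps)
      finally have "0 \<le> Q - \<epsilon> * (L M)\<^sup>2" by simp
      then show "0 \<le> qform I (\<lambda>i j. (\<Sum>e\<in>E. c e * (u i * u j) ^ e) - \<epsilon> * (u i * u j) ^ M) v"
        by (simp add: qform_diff qform_sum qform_scale pw Q_def)
    qed (simp add: mult.commute)
  qed
qed

text \<open>
  The induction on the number of exponents compares \<open>a\<close> with the rank-one matrix of its \<open>k\<close>-th
  column, as described at the beginning.  Both the rank-one lemma and the induction hypothesis
  are needed with their own threshold, for \<open>\<epsilon>\<close> and for \<open>M \<epsilon>\<close> respectively; this is why the
  statement is about all \<open>\<epsilon> \<le> \<delta>\<close>.
\<close>

theorem entrywise_psd: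
  fixes c :: "nat \<Rightarrow> real"
  assumes "finite E" and "E \<subseteq> {..<M}" and "\<And>e. e \<in> E \<Longrightarrow> 0 < c e" and "0 < \<rho>"
  shows "\<exists>\<delta>>0. \<forall>\<epsilon>\<le>\<delta>. \<forall>(I :: 'i set) a. finite I \<longrightarrow> card I \<le> card E \<longrightarrow>
    psd_on I a \<longrightarrow> (\<forall>i\<in>I. \<forall>j\<in>I. a i j \<in> {0<..<\<rho>}) \<longrightarrow>
    psd_on I (\<lambda>i j. (\<Sum>e\<in>E. c e * a i j ^ e) - \<epsilon> * a i j ^ M)"
  using assms(1-3)
proof (induction "card E" arbitrary: E M c)
  case 0
  then show ?case by (intro exI[of _ 1]) (auto simp: psd_on_def qform_def)
next
  case (Suc m)
  define b where "b = Min E"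
  have bE: "b \<in> E" and bmin: "\<And>e. e \<in> E \<Longrightarrow> b \<le> e"
    using Suc.hyps(2) Suc.prems(1) unfolding b_def by (auto intro!: Min_in)
  \<comment> \<open>The exponents and coefficients of the derivative, without the term of lowest degree.\<close>
  define E' where "E' = Suc -` (E - {b})"
  have EE: "E - {b} = Suc ` E'"
  proof -
    have "e \<in> range Suc" if "e \<in> E - {b}" for e
      using bmin[of e] that by (cases e) auto
    then show ?thesis by (auto simp: E'_def)
  qed
  have E': "finite E'" "m = card E'" "E' \<subseteq> {..<M - 1}"
  proof -
    show "finite E'" unfolding E'_def using Suc.prems(1) by (intro finite_vimageI) auto
    have "card (E - {b}) = m" using Suc.hyps(2) Suc.prems(1) bE by simp
    then show "m = card E'" unfolding EE by (simp add: card_image)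
    show "E' \<subseteq> {..<M - 1}" unfolding E'_def using Suc.prems(2) by auto
  qed
  define c' where "c' e = real (Suc e) * c (Suc e)" for e
  have c': "0 < c' e" if "e \<in> E'" for e
    unfolding c'_def using that Suc.prems(3) by (auto simp: E'_def)
  have M: "0 < M" using bE Suc.prems(2) by auto
  have "0 < sqrt \<rho>" using \<open>0 < \<rho>\<close> by simp
  from rank_one_entrywise_psd[where c = c, OF Suc.prems this]
  obtain \<delta>1 where \<delta>1: "\<delta>1 > 0" and "\<forall>\<epsilon>\<le>\<delta>1. \<forall>(I :: 'i set) u. finite I \<longrightarrow> card I \<le> card E \<longrightarrow>
      (\<forall>i\<in>I. u i \<in> {0<..sqrt \<rho>}) \<longrightarrow>
      psd_on I (\<lambda>i j. (\<Sum>e\<in>E. c e * (u i * u j) ^ e) - \<epsilon> * (u i * u j) ^ M)"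
    by blast
  note rank1 = this(2)[rule_format]
  from Suc.hyps(1)[where c = c', OF E'(2,1,3) c']
  obtain \<delta>2 where \<delta>2: "\<delta>2 > 0" and "\<forall>\<epsilon>\<le>\<delta>2. \<forall>(I :: 'i set) a. finite I \<longrightarrow> card I \<le> m \<longrightarrow>
      psd_on I a \<longrightarrow> (\<forall>i\<in>I. \<forall>j\<in>I. a i j \<in> {0<..<\<rho>}) \<longrightarrow>
      psd_on I (\<lambda>i j. (\<Sum>e\<in>E'. c' e * a i j ^ e) - \<epsilon> * a i j ^ (M - 1))"
    unfolding E'(2)[symmetric] by blast
  note IH = this(2)[rule_format]
  define \<delta> where "\<delta> = min \<delta>1 (\<delta>2 / real M)"
  show ?case
  proof (intro exI[of _ \<delta>] conjI allI impI)
    show "0 < \<delta>" using \<delta>1 \<delta>2 M by (simp add: \<delta>_def)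
  next
    fix \<epsilon> and I :: "'i set" and a
    assume \<epsilon>: "\<epsilon> \<le> \<delta>" and I: "finite I" "card I \<le> card E" and a: "psd_on I a"
      and rng: "\<forall>i\<in>I. \<forall>j\<in>I. a i j \<in> {0<..<\<rho>}"
    have \<epsilon>1: "\<epsilon> \<le> \<delta>1" and \<epsilon>2: "real M * \<epsilon> \<le> \<delta>2"
      using \<epsilon> M by (auto simp: \<delta>_def field_simps)
    define F where "F x = (\<Sum>e\<in>E. c e * x ^ e) - \<epsilon> * x ^ M" for x
    define F' where "F' x = (\<Sum>e\<in>E. c e * (real e * x ^ (e - 1))) - \<epsilon> * (real M * x ^ (M - 1))" for x
    have dF: "(F has_real_derivative F' x) (at x)" for x
      unfolding F_def F'_def by (auto intro!: derivative_eq_intros sum.cong)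
    \<comment> \<open>If \<open>b = 0\<close>, the first term vanishes thanks to the factor \<open>real b\<close>.\<close>
    have F'_eq: "F' x = c b * real b * x ^ (b - 1)
        + ((\<Sum>e\<in>E'. c' e * x ^ e) - real M * \<epsilon> * x ^ (M - 1))" for x
    proof -
      have "(\<Sum>e\<in>E. c e * (real e * x ^ (e - 1)))
          = c b * (real b * x ^ (b - 1)) + (\<Sum>e\<in>E - {b}. c e * (real e * x ^ (e - 1)))"
        by (rule sum.remove[OF Suc.prems(1) bE])
      also have "(\<Sum>e\<in>E - {b}. c e * (real e * x ^ (e - 1))) = (\<Sum>e\<in>E'. c' e * x ^ e)"
        unfolding EE by (subst sum.reindex) (auto simp: c'_def mult_ac)
      finally show ?thesis by (simp add: F'_def)
    qed
    show "psd_on I (\<lambda>i j. (\<Sum>e\<in>E. c e * a i j ^ e) - \<epsilon> * a i j ^ M)"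
    proof (cases "I = {}")
      case True
      then show ?thesis by (simp add: psd_on_def qform_def)
    next
      case False
      then obtain k where k: "k \<in> I" by blast
      have akk: "0 < a k k" using rng k by simp
      define u where "u i = a i k / sqrt (a k k)" for i
      define h where "h i j = a i j - u i * u j" for i j
      have uu: "u i * u j = a i k * a j k / a k k" for i j
        using akk by (simp add: u_def)
      have u: "0 < u i" "u i < sqrt \<rho>" if i: "i \<in> I" for i
      proof -
        show "0 < u i" using rng i k by (simp add: u_def)
        have "(u i)\<^sup>2 \<le> a i i"
          using psd_on_entry_square_le[OF a I(1) i k] akk
          by (simp add: u_def power_divide divide_le_eq)
        also have "\<dots> < \<rho>" using rng i by simp
        finally show "u i < sqrt \<rho>" by (rule real_less_rsqrt)
      qed
      have uu_rng: "0 < u i * u j \<and> u i * u j < \<rho>" if "i \<in> I" "j \<in> I" for i j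
        using mult_strict_mono[of "u i" "sqrt \<rho>" "u j" "sqrt \<rho>"] u[OF that(1)] u[OF that(2)] \<open>0 < \<rho>\<close>
        by simp
      have h: "psd_on I h"
        using psd_on_Schur_complement[OF a I(1) k] unfolding h_def uu .
      have hcol: "h i k = 0" if "i \<in> I" for i
        using akk by (simp add: h_def uu)
      have hrow: "h k i = 0" if "i \<in> I" for i
        using hcol[OF that] psd_on_sym[OF h that k] by simp
      define J where "J = I - {k}"
      have J: "finite J" "J \<subseteq> I" "card J \<le> m"
        using I k Suc.hyps(2) by (auto simp: J_def)
      \<comment> \<open>The segment from the rank-one matrix to \<open>a\<close>.\<close>
      define s where "s t i j = u i * u j + t * h i j" for t i j
      have psd_deriv: "psd_on J (\<lambda>i j. h i j * F' (s t i j))" if t: "0 \<le> t" "t \<le> 1" for t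
      proof (rule Schur_product[OF J(1) psd_on_subset[OF h I(1) J(2)]])
        have "psd_on I (s t)"
          unfolding s_def using h t psd_on_add[OF psd_on_rank_one psd_on_scale] by blast
        then have sJ: "psd_on J (s t)" using psd_on_subset I(1) J(2) by blast
        have srng: "s t i j \<in> {0<..<\<rho>}" if "i \<in> J" "j \<in> J" for i j
        proof -
          have "i \<in> I" "j \<in> I" using that J(2) by auto
          then have "u i * u j \<in> {0<..<\<rho>}" "a i j \<in> {0<..<\<rho>}"
            using uu_rng rng by auto
          from convexD[OF convex_real_interval(8) this, of "1 - t" t]
          have "(1 - t) * (u i * u j) + t * a i j \<in> {0<..<\<rho>}"
            using t by simp
          moreover have "s t i j = (1 - t) * (u i * u j) + t * a i j"
            by (simp add: s_def h_def algebra_simps)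
          ultimately show ?thesis by simp
        qed
        have "0 \<le> c b * real b" using Suc.prems(3)[OF bE] by simp
        then show "psd_on J (\<lambda>i j. F' (s t i j))"
          unfolding F'_eq
          using psd_on_add[OF psd_on_scale[OF psd_on_power[OF J(1) sJ]] IH[OF \<epsilon>2 J(1,3) sJ srng]]
          by blast
      qed
      have "psd_on I (\<lambda>i j. F (a i j))"
      proof (rule psd_onI)
        fix i j assume "i \<in> I" "j \<in> I"
        then show "F (a i j) = F (a j i)" using psd_on_sym[OF a] by simp
      next
        fix v
        define \<phi> where "\<phi> t = qform I (\<lambda>i j. F (s t i j)) v" for t
        have d\<phi>: "(\<phi> has_real_derivative qform I (\<lambda>i j. h i j * F' (s t i j)) v) (at t)" for t
        proof -
          have "((\<lambda>t. F (s t i j)) has_real_derivative h i j * F' (s t i j)) (at t)" for i j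
          proof -
            have "((\<lambda>t. s t i j) has_real_derivative h i j) (at t)"
              unfolding s_def by (auto intro!: derivative_eq_intros)
            from DERIV_chain2[OF dF this] show ?thesis by (simp add: mult.commute)
          qed
          then show ?thesis
            unfolding \<phi>_def qform_def by (auto intro!: derivative_eq_intros sum.cong)
        qed
        have "\<phi> 0 \<le> \<phi> 1"
        proof (rule DERIV_nonneg_imp_nondecreasing[where f = \<phi> and a = 0 and b = 1])
          fix t :: real assume t: "0 \<le> t" "t \<le> 1"
          have "qform I (\<lambda>i j. h i j * F' (s t i j)) v = qform J (\<lambda>i j. h i j * F' (s t i j)) v"
            using hrow hcol by (intro qform_subset I J) (auto simp: J_def)
          then have "0 \<le> qform I (\<lambda>i j. h i j * F' (s t i j)) v"
            using psd_on_nonneg[OF psd_deriv[OF t]] by simp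
          with d\<phi> show "\<exists>y. (\<phi> has_real_derivative y) (at t) \<and> 0 \<le> y" by blast
        qed simp
        moreover have "0 \<le> \<phi> 0"
          using psd_on_nonneg[OF rank1[OF \<epsilon>1 I, of u]] u
          by (simp add: \<phi>_def s_def F_def less_imp_le)
        ultimately show "0 \<le> qform I (\<lambda>i j. F (a i j)) v"
          by (simp add: \<phi>_def s_def h_def)
      qed
      then show ?thesis by (simp add: F_def)
    qed
  qed
qed

section \<open>Complex Hermitian matrices with real entries\<close>

lemma psd_mat_imp_psd_on:
  assumes A: "A \<in> carrier_mat N N" and "psd_mat A"
    and ent: "\<And>i j. i < N \<Longrightarrow> j < N \<Longrightarrow> A $$ (i, j) = of_real (a i j)"
  shows "psd_on {..<N} a"
proof (rule psd_onI)
  fix i j assume "i \<in> {..<N}" "j \<in> {..<N}"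
  then have ij: "i < N" "j < N" by auto
  have "mat_adjoint A = A"
    using assms by (simp add: psd_mat_def hermitian_mat_def)
  then have "A $$ (i, j) = mat_adjoint A $$ (i, j)" by simp
  also have "\<dots> = cnj (A $$ (j, i))"
    using A ij by (simp add: mat_adjoint_def mat_of_rows_index)
  finally show "a i j = a j i"
    using ij by (simp add: ent)
next
  fix v :: "nat \<Rightarrow> real"
  define w where "w = vec N (\<lambda>i. complex_of_real (v i))"
  have "0 \<le> (A *\<^sub>v w) \<bullet>c w"
    using assms by (auto simp: psd_mat_def w_def)
  also have "(A *\<^sub>v w) \<bullet>c w = of_real (qform {..<N} a v)"
    using A by (auto simp: w_def scalar_prod_def qform_def ent sum_distrib_left sum_distrib_right
        mult_ac lessThan_atLeast0 intro!: sum.cong)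
  finally show "0 \<le> qform {..<N} a v"
    by (simp add: less_eq_complex_def)
qed

text \<open>By symmetry of \<open>a\<close>, the Hermitian form at \<open>x + \<i> y\<close> is the sum of the real forms at \<open>x\<close>
  and at \<open>y\<close>: the mixed terms make up the imaginary part, and cancel.\<close>

lemma psd_on_imp_psd_mat:
  assumes A: "A \<in> carrier_mat N N" and a: "psd_on {..<N} a"
    and ent: "\<And>i j. i < N \<Longrightarrow> j < N \<Longrightarrow> A $$ (i, j) = of_real (a i j)"
  shows "psd_mat A"
  unfolding psd_mat_def hermitian_mat_def
proof (intro conjI ballI)
  show "square_mat A" using A by simp
  show "mat_adjoint A = A"
    using A psd_on_sym[OF a] by (intro eq_matI) (auto simp: mat_adjoint_def mat_of_rows_index ent)
next
  fix v :: "complex vec" assume "v \<in> carrier_vec (dim_row A)"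
  then have v: "dim_vec v = N" using A by auto
  define x where "x i = Re (v $ i)" for i
  define y where "y i = Im (v $ i)" for i
  have "(A *\<^sub>v v) \<bullet>c v = (\<Sum>i<N. \<Sum>j<N. of_real (a i j) * v $ j * cnj (v $ i))"
    using A v by (auto simp: scalar_prod_def ent sum_distrib_right lessThan_atLeast0 intro!: sum.cong)
  moreover have "Re (\<Sum>i<N. \<Sum>j<N. of_real (a i j) * v $ j * cnj (v $ i))
      = qform {..<N} a x + qform {..<N} a y"
    unfolding qform_def sum.distrib[symmetric] Re_sum
    by (intro sum.cong) (simp_all add: x_def y_def algebra_simps)
  moreover have "Im (\<Sum>i<N. \<Sum>j<N. of_real (a i j) * v $ j * cnj (v $ i))
      = (\<Sum>i<N. \<Sum>j<N. a i j * y j * x i) - (\<Sum>i<N. \<Sum>j<N. a i j * x j * y i)"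
    unfolding sum_subtractf[symmetric] Im_sum
    by (intro sum.cong) (simp_all add: x_def y_def algebra_simps)
  moreover have "(\<Sum>i<N. \<Sum>j<N. a i j * x j * y i) = (\<Sum>i<N. \<Sum>j<N. a i j * y j * x i)"
    by (subst sum.swap, intro sum.cong refl) (simp add: psd_on_sym[OF a])
  ultimately show "0 \<le> (A *\<^sub>v v) \<bullet>c v"
    using psd_on_nonneg[OF a, of x] psd_on_nonneg[OF a, of y] by (simp add: less_eq_complex_def)
qed

theorem theorem1p6:
  fixes N M :: nat and n :: "nat \<Rightarrow> nat" and \<rho> :: real and c :: "nat \<Rightarrow> real"
  assumes "N > 0"
    and "strict_mono_on {..<N} n"
    and "n (N - 1) < M"
    and "0 < \<rho>"
    and "\<And>j. j < N \<Longrightarrow> 0 < c (n j)"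
  shows "\<exists>c\<^sub>M::real. c\<^sub>M < 0 \<and>
    entrywise_preserves_positivity
      (\<lambda>x. (\<Sum>j<N. of_real (c (n j)) * x ^ n j) + of_real c\<^sub>M * x ^ M)
      N (of_real ` {0<..<\<rho>})"
proof -
  define E where "E = n ` {..<N}"
  have inj: "inj_on n {..<N}"
    using assms(2) by (rule strict_mono_on_imp_inj_on)
  have "n j \<le> n (N - 1)" if "j < N" for j
    using strict_mono_onD[OF assms(2), of j "N - 1"] that
    by (cases "j = N - 1") (auto simp: less_imp_le)
  then have E: "finite E" "E \<subseteq> {..<M}" "card E = N" "\<And>e. e \<in> E \<Longrightarrow> 0 < c e"
    using assms(3,5) by (force simp: E_def card_image[OF inj])+
  obtain \<delta> where \<delta>: "\<delta> > 0" and "\<forall>\<epsilon>\<le>\<delta>. \<forall>(I :: nat set) a. finite I \<longrightarrow> card I \<le> N \<longrightarrow>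
      psd_on I a \<longrightarrow> (\<forall>i\<in>I. \<forall>j\<in>I. a i j \<in> {0<..<\<rho>}) \<longrightarrow>
      psd_on I (\<lambda>i j. (\<Sum>e\<in>E. c e * a i j ^ e) - \<epsilon> * a i j ^ M)"
    using entrywise_psd[where c = c, OF E(1,2,4) assms(4)] unfolding E(3) by blast
  note psd = this(2)[rule_format, OF order_refl]
  let ?f = "\<lambda>x. (\<Sum>j<N. of_real (c (n j)) * x ^ n j) + of_real (- \<delta>) * x ^ M :: complex"
  have "psd_mat (map_mat ?f A)" if "A \<in> psd_mats N (of_real ` {0<..<\<rho>})" for A
  proof -
    have A: "A \<in> carrier_mat N N" "psd_mat A" "elements_mat A \<subseteq> of_real ` {0<..<\<rho>}"
      using that by (auto simp: psd_mats_def)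
    define a where "a i j = Re (A $$ (i, j))" for i j
    have ent: "A $$ (i, j) = of_real (a i j) \<and> a i j \<in> {0<..<\<rho>}" if "i < N" "j < N" for i j
    proof -
      have "A $$ (i, j) \<in> elements_mat A"
        using A(1) that unfolding elements_mat_def by force
      then show ?thesis using A(3) by (auto simp: a_def)
    qed
    have "psd_on {..<N} a"
      using psd_mat_imp_psd_on[OF A(1,2)] ent by blast
    then have "psd_on {..<N} (\<lambda>i j. (\<Sum>e\<in>E. c e * a i j ^ e) - \<delta> * a i j ^ M)"
      using ent by (intro psd) auto
    moreover have "map_mat ?f A $$ (i, j) = of_real ((\<Sum>e\<in>E. c e * a i j ^ e) - \<delta> * a i j ^ M)"
      if "i < N" "j < N" for i j
      using A(1) that ent[OF that] by (simp add: E_def sum.reindex[OF inj])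
    ultimately show ?thesis
      using A(1) by (intro psd_on_imp_psd_mat) auto
  qed
  then show ?thesis
    using \<delta> by (intro exI[of _ "- \<delta>"]) (auto simp: entrywise_preserves_positivity_def)
qed

end
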